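(* Let $N$ be the number of sensors, let $|\psi_0\rangle\in(\mathbb{C}^2)^{\otimes N}$ be any pure (normalised) $N$-qubit probe state, and let $\hat{\boldsymbol{w}},\hat{\boldsymbol{v}}\in\mathbb{R}^N$ be unit vectors with $\hat{\boldsymbol{w}}\perp\hat{\boldsymbol{v}}$. For every $\delta>0$, if $\mathcal{F}_Q(\hat{\boldsymbol{v}}^\top\boldsymbol{\theta})\ge\delta$, then $\mathcal{F}_Q(\hat{\boldsymbol{w}}^\top\boldsymbol{\theta})\le N-\delta$. In particular, if $\mathcal{F}_Q(\hat{\boldsymbol{w}}^\top\boldsymbol{\theta})=N$ (Heisenberg-limited precision for direction $\hat{\boldsymbol{w}}$), then $\mathcal{F}_Q(\hat{\boldsymbol{v}}^\top\boldsymbol{\theta})=0$ for every unit vector $\hat{\boldsymbol{v}}\perp\hat{\boldsymbol{w}}$.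
   Context: Setting: $N$ sensors each hold one qubit of a normalised pure probe state $|\psi_0\rangle\in(\mathbb{C}^2)^{\otimes N}$. Let $\sigma_z=\mathrm{diag}(1,-1)$ be the Pauli $Z$ operator and $\sigma_z^{(j)}=I\otimes\cdots\otimes\sigma_z\otimes\cdots\otimes I$ with $\sigma_z$ acting on the $j$-th qubit. The encoded state is $|\psi(\boldsymbol{\theta})\rangle=\exp\left(-\frac{i}{2}\sum_{j=1}^N\theta_j\sigma_z^{(j)}\right)|\psi_0\rangle$ with $\boldsymbol{\theta}=(\theta_1,\dots,\theta_N)\in[0,2\pi)^N$. Quantum Fisher information matrix (QFIM): with $\rho(\boldsymbol{\theta})=|\psi(\boldsymbol{\theta})\rangle\langle\psi(\boldsymbol{\theta})|$, $[\mathcal{F}_Q(\boldsymbol{\theta})]_{ij}=\frac12\mathrm{Tr}[\rho(\boldsymbol{\theta})\{L_i,L_j\}]$, where $\{A,B\}=AB+BA$ and $L_i$ is the symmetric logarithmic derivative, defined by $\partial\rho(\boldsymbol{\theta})/\partial\theta_i=\{L_i,\rho(\boldsymbol{\theta})\}/2$. For this encoding the QFIM is given by the known formula (which may be taken as its definition) $$[\mathcal{F}_Q(\boldsymbol{\theta})]_{ij}=\langle\sigma_z^{(i)}\sigma_z^{(j)}\rangle-\langle\sigma_z^{(i)}\rangle\langle\sigma_z^{(j)}\rangle,\qquad \langle A\rangle=\langle\psi_0|A|\psi_0\rangle.$$ For $\boldsymbol{u}\in\mathbb{R}^N$, the quantum Fisher information for $\boldsymbol{u}^\top\boldsymbol{\theta}$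 is $\mathcal{F}_Q(\boldsymbol{u}^\top\boldsymbol{\theta})=\boldsymbol{u}^\top\mathcal{F}_Q(\boldsymbol{\theta})\boldsymbol{u}$. *)

theory Defs
  imports "HOL-Analysis.Analysis"
begin

text \<open>
  The qubits are indexed by a finite type \<open>'n\<close>, so that \<open>N = CARD('n)\<close>. The space
  \<open>(\<complex>\<^sup>2)\<^bsup>\<otimes>N\<^esup>\<close> is represented by coordinates in the computational basis, whose elements are
  the functions \<open>s :: 'n \<Rightarrow> 2\<close> (\<open>s j\<close> is the basis state of qubit \<open>j\<close>). The norm of
  \<open>complex ^ ('n \<Rightarrow> 2)\<close> is the Hilbert space norm.
\<close>

type_synonym 'n qubits = "complex ^ ('n \<Rightarrow> 2)"

type_synonym 'n qubit_op = "complex ^ ('n \<Rightarrow> 2) ^ ('n \<Rightarrow> 2)"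

definition sigma_z :: "complex ^ 2 ^ 2"
  where "sigma_z = vector [vector [1, 0], vector [0, - 1]]"

definition tensor_op :: "('n::finite \<Rightarrow> complex ^ 2 ^ 2) \<Rightarrow> 'n qubit_op"
  where "tensor_op A = (\<chi> s t. \<Prod>k\<in>UNIV. A k $ s k $ t k)"

definition sigma_z_at :: "'n::finite \<Rightarrow> 'n qubit_op"
  where "sigma_z_at j = tensor_op (\<lambda>k. if k = j then sigma_z else mat 1)"

definition expval :: "'n::finite qubits \<Rightarrow> 'n qubit_op \<Rightarrow> complex"
  where "expval \<psi> A = (\<Sum>s\<in>UNIV. cnj (\<psi> $ s) * (A *v \<psi>) $ s)"

text \<open>
  The quantum Fisher information matrix of the encoding
  \<open>exp (- (\<i>/2) \<Sum>\<^sub>j \<theta>\<^sub>j \<sigma>\<^sub>z\<^bsup>(j)\<^esup>) \<psi>\<close>, given by its covariance formula; it does not depend on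
  \<open>\<theta>\<close>. Taking the real part loses nothing, see \<open>qfim_complex\<close> below.
\<close>

definition qfim :: "'n::finite qubits \<Rightarrow> real ^ 'n ^ 'n"
  where "qfim \<psi> = (\<chi> i j. Re (expval \<psi> (sigma_z_at i ** sigma_z_at j)
           - expval \<psi> (sigma_z_at i) * expval \<psi> (sigma_z_at j)))"

definition qfi :: "'n::finite qubits \<Rightarrow> real ^ 'n \<Rightarrow> real"
  where "qfi \<psi> u = u \<bullet> (qfim \<psi> *v u)"

lemma sigma_z_entry: "sigma_z $ a $ b = (if a = b then if a = 1 then 1 else - 1 else 0)"
  using exhaust_2[of a] exhaust_2[of b] by (auto simp: sigma_z_def)

lemma sigma_z_at_entry:
  "sigma_z_at j $ s $ t = (if s = t then if s j = 1 then 1 else - 1 else 0)"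
proof (cases "s = t")
  case True
  have "sigma_z_at j $ s $ t
      = (\<Prod>k\<in>UNIV. if k = j then if s j = 1 then 1 else - 1 else 1)"
    unfolding sigma_z_at_def tensor_op_def vec_lambda_beta
    by (rule prod.cong) (simp_all add: True sigma_z_entry mat_def)
  then show ?thesis using True by simp
next
  case False
  then obtain k where "s k \<noteq> t k" by blast
  then have "(if k = j then sigma_z else mat 1) $ s k $ t k = (0::complex)"
    by (auto simp: sigma_z_entry mat_def)
  then have "sigma_z_at j $ s $ t = 0"
    unfolding sigma_z_at_def tensor_op_def vec_lambda_beta
    by (intro prod_zero bexI[of _ k]) simp_all
  then show ?thesis using False by simp
qed

lemma sigma_z_at_mult_entry:
  "(sigma_z_at i ** sigma_z_at j) $ s $ t
     = (if s = t then (if s i = 1 then 1 else - 1) * (if s j = 1 then 1 else - 1) else 0)"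
proof -
  have "(sigma_z_at i ** sigma_z_at j) $ s $ t
      = (\<Sum>r\<in>UNIV. if s = r then (if s i = 1 then 1 else - 1) * sigma_z_at j $ r $ t else 0)"
    unfolding matrix_matrix_mult_def vec_lambda_beta
    by (rule sum.cong) (simp_all add: sigma_z_at_entry[of i])
  also have "\<dots> = (if s i = 1 then 1 else - 1) * sigma_z_at j $ s $ t"
    by simp
  finally show ?thesis by (simp add: sigma_z_at_entry)
qed

lemma expval_real_diag:
  assumes "\<And>s t. A $ s $ t = (if s = t then complex_of_real (d s) else 0)"
  shows "expval \<psi> A \<in> \<real>"
proof -
  have "(A *v \<psi>) $ s = of_real (d s) * \<psi> $ s" for s
    unfolding matrix_vector_mult_def by (simp add: assms if_distrib [of "\<lambda>x. x * _"] cong: if_cong)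
  then have "expval \<psi> A = (\<Sum>s\<in>UNIV. of_real (d s) * (\<psi> $ s * cnj (\<psi> $ s)))"
    unfolding expval_def by (simp add: mult_ac)
  also have "\<dots> = (\<Sum>s\<in>UNIV. of_real (d s * (cmod (\<psi> $ s))\<^sup>2))"
    by (simp only: complex_norm_square of_real_mult)
  finally show ?thesis by simp
qed

lemma qfim_complex:
  "complex_of_real (qfim \<psi> $ i $ j)
     = expval \<psi> (sigma_z_at i ** sigma_z_at j)
       - expval \<psi> (sigma_z_at i) * expval \<psi> (sigma_z_at j)"
proof -
  have 1: "expval \<psi> (sigma_z_at k) \<in> \<real>" for k
    by (rule expval_real_diag[where d = "\<lambda>s. if s k = 1 then 1 else - 1"])
      (simp add: sigma_z_at_entry)
  have "expval \<psi> (sigma_z_at i ** sigma_z_at j) \<in> \<real>"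
    by (rule expval_real_diag[where
          d = "\<lambda>s. (if s i = 1 then 1 else - 1) * (if s j = 1 then 1 else - 1)"])
      (simp add: sigma_z_at_mult_entry)
  with 1 show ?thesis
    by (simp add: qfim_def of_real_Re complex_is_Real_iff complex_eq_iff)
qed

end

theory Submission imports Defs begin

text \<open>
  Measuring \<open>\<psi>\<close> in the computational basis gives a random vector of signs \<open>x \<in> {-1, 1}\<^sup>N\<close>, and
  \<open>qfi \<psi> u\<close> is the variance of \<open>u \<bullet> x\<close>. For orthonormal \<open>w\<close> and \<open>v\<close>, the two variances add up to at
  most the expectation of \<open>(w \<bullet> x)\<^sup>2 + (v \<bullet> x)\<^sup>2\<close>, which Bessel's inequality bounds by
  \<open>\<parallel>x\<parallel>\<^sup>2 = N\<close>.
\<close>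

text \<open>The eigenvalues of the operators \<open>sigma_z_at j\<close> on basis state
  \<open>s\<close>, gathered into one vector, so that \<open>\<Sum>j. u $ j * sigma_z_at j\<close>
  has eigenvalue \<open>u \<bullet> spin s\<close>. Index \<open>1\<close> is the +1
  eigenstate.\<close>

definition spin :: "('n::finite \<Rightarrow> 2) \<Rightarrow> real ^ 'n"
  where "spin s = (\<chi> j. if s j = 1 then 1 else - 1)"

lemma inner_spin_self: "spin s \<bullet> spin (s :: 'n::finite \<Rightarrow> 2) = real CARD('n)"
proof -
  have "spin s $ j * spin s $ j = 1" for j
    by (simp add: spin_def)
  then show ?thesis
    by (simp add: inner_vec_def)
qed

text \<open>Born rule: in a diagonal operator each basis state contributes its eigenvalue, weighted
  by the squared modulus of its amplitude.\<close>

lemma expval_diag: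
  assumes "\<And>s t. A $ s $ t = (if s = t then complex_of_real (d s) else 0)"
  shows "expval \<psi> A = of_real (\<Sum>s\<in>UNIV. (cmod (\<psi> $ s))\<^sup>2 * d s)"
proof -
  have "(A *v \<psi>) $ s = of_real (d s) * \<psi> $ s" for s
    unfolding matrix_vector_mult_def
    by (simp add: assms if_distrib [of "\<lambda>x. x * _"] cong: if_cong)
  then have "expval \<psi> A = (\<Sum>s\<in>UNIV. (\<psi> $ s * cnj (\<psi> $ s)) * of_real (d s))"
    unfolding expval_def by (simp add: mult_ac)
  also have "\<dots> = of_real (\<Sum>s\<in>UNIV. (cmod (\<psi> $ s))\<^sup>2 * d s)"
    by (simp only: complex_norm_square of_real_mult of_real_sum)
  finally show ?thesis .
qed

text \<open>The \<open>sigma_z_at\<close> and their products are all diagonal in the computational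
  basis, so the quantum covariance is the classical one of the signs.\<close>

lemma qfim_eq_covariance:
  "qfim \<psi> $ i $ j
     = (\<Sum>s\<in>UNIV. (cmod (\<psi> $ s))\<^sup>2 * (spin s $ i * spin s $ j))
       - (\<Sum>s\<in>UNIV. (cmod (\<psi> $ s))\<^sup>2 * spin s $ i) * (\<Sum>s\<in>UNIV. (cmod (\<psi> $ s))\<^sup>2 * spin s $ j)"
proof -
  have 1: "expval \<psi> (sigma_z_at k) = of_real (\<Sum>s\<in>UNIV. (cmod (\<psi> $ s))\<^sup>2 * spin s $ k)" for k
    by (rule expval_diag) (simp add: sigma_z_at_entry spin_def)
  have 2: "expval \<psi> (sigma_z_at i ** sigma_z_at j)
      = of_real (\<Sum>s\<in>UNIV. (cmod (\<psi> $ s))\<^sup>2 * (spin s $ i * spin s $ j))"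
    by (rule expval_diag) (simp add: sigma_z_at_mult_entry spin_def)
  show ?thesis
    unfolding qfim_def vec_lambda_beta 1 2 of_real_mult[symmetric] of_real_diff[symmetric]
    by (rule Re_complex_of_real)
qed

lemma qfi_eq_variance:
  "qfi \<psi> u = (\<Sum>s\<in>UNIV. (cmod (\<psi> $ s))\<^sup>2 * (u \<bullet> spin s)\<^sup>2)
     - (\<Sum>s\<in>UNIV. (cmod (\<psi> $ s))\<^sup>2 * (u \<bullet> spin s))\<^sup>2"
proof -
  define p where "p s = (cmod (\<psi> $ s))\<^sup>2" for s
  define m where "m i = (\<Sum>s\<in>UNIV. p s * spin s $ i)" for i
  \<comment> \<open>Both moments are brought to the form of a double sum over \<open>i\<close> and
    \<open>j\<close>, with \<open>u $ i\<close> in front and \<open>u $ j\<close> at the end, which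
    is the shape that the quadratic form \<open>qfi\<close> unfolds to.\<close>
  have "(\<Sum>s\<in>UNIV. p s * (u \<bullet> spin s)\<^sup>2)
      = (\<Sum>s\<in>UNIV. \<Sum>i\<in>UNIV. \<Sum>j\<in>UNIV. u $ i * (p s * (spin s $ i * spin s $ j) * u $ j))"
  proof (rule sum.cong[OF refl])
    fix s
    have "(u \<bullet> spin s)\<^sup>2 = (\<Sum>i\<in>UNIV. \<Sum>j\<in>UNIV. (u $ i * spin s $ i) * (u $ j * spin s $ j))"
      by (simp add: inner_vec_def power2_eq_square sum_product)
    then show "p s * (u \<bullet> spin s)\<^sup>2
        = (\<Sum>i\<in>UNIV. \<Sum>j\<in>UNIV. u $ i * (p s * (spin s $ i * spin s $ j) * u $ j))"
      by (simp add: sum_distrib_left mult_ac)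
  qed
  also have "\<dots> = (\<Sum>i\<in>UNIV. \<Sum>s\<in>UNIV. \<Sum>j\<in>UNIV. u $ i * (p s * (spin s $ i * spin s $ j) * u $ j))"
    by (rule sum.swap)
  also have "\<dots> = (\<Sum>i\<in>UNIV. \<Sum>j\<in>UNIV. \<Sum>s\<in>UNIV. u $ i * (p s * (spin s $ i * spin s $ j) * u $ j))"
    by (intro sum.cong refl sum.swap)
  finally have second: "(\<Sum>s\<in>UNIV. p s * (u \<bullet> spin s)\<^sup>2)
      = (\<Sum>i\<in>UNIV. \<Sum>j\<in>UNIV. u $ i * ((\<Sum>s\<in>UNIV. p s * (spin s $ i * spin s $ j)) * u $ j))"
    by (simp add: sum_distrib_left sum_distrib_right)
  have "(\<Sum>s\<in>UNIV. p s * (u \<bullet> spin s)) = (\<Sum>s\<in>UNIV. \<Sum>i\<in>UNIV. u $ i * (p s * spin s $ i))"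
    by (simp add: inner_vec_def sum_distrib_left mult_ac)
  also have "\<dots> = (\<Sum>i\<in>UNIV. u $ i * m i)"
    unfolding m_def by (subst sum.swap) (simp add: sum_distrib_left)
  finally have first: "(\<Sum>s\<in>UNIV. p s * (u \<bullet> spin s))\<^sup>2
      = (\<Sum>i\<in>UNIV. \<Sum>j\<in>UNIV. u $ i * (m i * m j * u $ j))"
    by (simp add: power2_eq_square sum_product mult_ac)
  have "qfi \<psi> u = (\<Sum>i\<in>UNIV. \<Sum>j\<in>UNIV. u $ i * (qfim \<psi> $ i $ j * u $ j))"
    by (simp add: qfi_def inner_vec_def matrix_vector_mult_def sum_distrib_left)
  then show ?thesis
    unfolding qfim_eq_covariance p_def[symmetric] first second m_def[symmetric]
    by (simp only: left_diff_distrib right_diff_distrib sum_subtractf)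
qed

lemma sum_cmod_power2: "(\<Sum>s\<in>UNIV. (cmod (\<psi> $ s))\<^sup>2) = (norm \<psi>)\<^sup>2"
  by (simp add: norm_vec_def L2_set_def sum_nonneg)

lemma qfi_nonneg:
  assumes "norm \<psi> = 1"
  shows "0 \<le> qfi \<psi> u"
proof -
  define p where "p s = (cmod (\<psi> $ s))\<^sup>2" for s
  define m where "m = (\<Sum>s\<in>UNIV. p s * (u \<bullet> spin s))"
  have p1: "(\<Sum>s\<in>UNIV. p s) = 1"
    by (simp add: p_def sum_cmod_power2 assms)
  have "0 \<le> (\<Sum>s\<in>UNIV. p s * (u \<bullet> spin s - m)\<^sup>2)"
    by (intro sum_nonneg) (simp add: p_def)
  also have "\<dots> = (\<Sum>s\<in>UNIV. p s * (u \<bullet> spin s)\<^sup>2 - 2 * m * (p s * (u \<bullet> spin s)) + m\<^sup>2 * p s)"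
    by (intro sum.cong refl) (simp add: power2_eq_square algebra_simps)
  \<comment> \<open>Normalisation enters here: the weights sum to 1, so the terms in
    \<open>m\<close> combine to \<open>- m\<^sup>2\<close>.\<close>
  also have "\<dots> = (\<Sum>s\<in>UNIV. p s * (u \<bullet> spin s)\<^sup>2) - 2 * m * m + m\<^sup>2 * 1"
    by (simp only: sum.distrib sum_subtractf sum_distrib_left[symmetric] p1 m_def[symmetric])
  also have "\<dots> = qfi \<psi> u"
    unfolding qfi_eq_variance p_def[symmetric] m_def[symmetric] by (simp add: power2_eq_square)
  finally show ?thesis .
qed

text \<open>The residual of \<open>x\<close> after projection onto the span of \<open>w\<close> and
  \<open>v\<close> has squared norm \<open>x \<bullet> x - (w \<bullet> x)\<^sup>2 - (v \<bullet>
  x)\<^sup>2\<close>, which cannot be negative.\<close>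

lemma Bessel_two:
  fixes w v x :: "'a::real_inner"
  assumes "norm w = 1" "norm v = 1" "orthogonal w v"
  shows "(w \<bullet> x)\<^sup>2 + (v \<bullet> x)\<^sup>2 \<le> x \<bullet> x"
proof -
  have "w \<bullet> w = 1" "v \<bullet> v = 1" "w \<bullet> v = 0" "v \<bullet> w = 0"
    using assms by (simp_all add: orthogonal_def inner_commute norm_eq_1)
  moreover have "0 \<le> (x - (w \<bullet> x) *\<^sub>R w - (v \<bullet> x) *\<^sub>R v) \<bullet> (x - (w \<bullet> x) *\<^sub>R w - (v \<bullet> x) *\<^sub>R v)"
    by simp
  ultimately show ?thesis
    by (simp add: inner_diff_left inner_diff_right inner_commute[of x w] inner_commute[of x v] power2_eq_square)
qed

lemma qfi_add_le:
  fixes \<psi> :: "'n::finite qubits"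
  assumes "norm \<psi> = 1" "norm w = 1" "norm v = 1" "orthogonal w v"
  shows "qfi \<psi> w + qfi \<psi> v \<le> real CARD('n)"
proof -
  define p where "p s = (cmod (\<psi> $ s))\<^sup>2" for s
  \<comment> \<open>Each variance is at most its second moment, since the subtracted squared mean is
    nonnegative.\<close>
  have "qfi \<psi> w + qfi \<psi> v \<le> (\<Sum>s\<in>UNIV. p s * (w \<bullet> spin s)\<^sup>2) + (\<Sum>s\<in>UNIV. p s * (v \<bullet> spin s)\<^sup>2)"
    unfolding qfi_eq_variance p_def by (intro add_mono) simp_all
  also have "\<dots> = (\<Sum>s\<in>UNIV. p s * ((w \<bullet> spin s)\<^sup>2 + (v \<bullet> spin s)\<^sup>2))"
    by (simp add: distrib_left sum.distrib)
  also have "\<dots> \<le> (\<Sum>s\<in>UNIV. p s * real CARD('n))"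
  proof (intro sum_mono mult_left_mono)
    show "(w \<bullet> spin s)\<^sup>2 + (v \<bullet> spin s)\<^sup>2 \<le> real CARD('n)" for s
      using Bessel_two[OF assms(2-4), of "spin s"] by (simp add: inner_spin_self)
  qed (simp add: p_def)
  also have "\<dots> = real CARD('n)"
    by (simp add: sum_distrib_right[symmetric] p_def sum_cmod_power2 assms(1))
  finally show ?thesis .
qed

theorem mainTheorem3:
  fixes \<psi> :: "'n::finite qubits" and w :: "real ^ 'n"
  assumes "norm \<psi> = 1" and "norm w = 1"
  shows "(\<forall>v. norm v = 1 \<and> orthogonal w v \<longrightarrow>
            (\<forall>\<delta>>0. qfi \<psi> v \<ge> \<delta> \<longrightarrow> qfi \<psi> w \<le> real CARD('n) - \<delta>))
       \<and> (qfi \<psi> w = real CARD('n) \<longrightarrow>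
            (\<forall>v. norm v = 1 \<and> orthogonal w v \<longrightarrow> qfi \<psi> v = 0))"
proof -
  \<comment> \<open>The sum bound gives the trade-off with \<open>\<delta>\<close>. When
    \<open>qfi \<psi> w\<close> attains \<open>N\<close>, it leaves
    \<open>qfi \<psi> v \<le> 0\<close>, and nonnegativity forces equality.\<close>
  have "qfi \<psi> w + qfi \<psi> v \<le> real CARD('n)" "0 \<le> qfi \<psi> v"
    if "norm v = 1 \<and> orthogonal w v" for v
    using qfi_add_le[OF assms] qfi_nonneg[OF assms(1)] that by blast+
  then show ?thesis
    by (smt (verit))
qed

end
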